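(* Let $A$ be an $m\times n$ real matrix with $n>m$, ${\rm rank}(A)=m$, columns ${\bf a}_1,\ldots,{\bf a}_n$, let ${\bf b}\in\mathbb{R}^m$, $P=\{{\bf x}\in\mathbb{R}^n:{\bf x}\geq0,\ A{\bf x}={\bf b}\}$, and let $X$ be the maximum-entropy random vector described in the context. Suppose that $n=pm$ for some integer $p$ and that for each $i=1,\ldots,m$ we have ${\bf a}_i={\bf a}_{m+i}={\bf a}_{2m+i}=\cdots={\bf a}_{(p-1)m+i}$, where $\{{\bf a}_1,\ldots,{\bf a}_m\}$ is a basis of $\mathbb{R}^m$. Then $$|P\cap\mathbb{Z}^n|\ \lesssim\ e^{H(X)}\prod_{i=1}^m\Big(\frac{\pi p}{6}\big(\lfloor{\bf E}(X_i)+1\rfloor^2-1\big)\Big)^{-1/2},$$ where $\lesssim$ means that, for fixed ${\bf a}_1,\ldots,{\bf a}_m$, the left-hand side is bounded above by a function which is asymptotic to the right-hand side as $p\to\infty$.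
   Context: $X=(X_1,\ldots,X_n)$ is the random vector with values in $\mathbb{Z}_{\geq 0}^n$ of maximum entropy subject to ${\bf E}[AX]={\bf b}$ (assumed to exist), with entropy $H(X)=-\sum_{{\bf k}}{\bf Pr}[X={\bf k}]\ln{\bf Pr}[X={\bf k}]$. Its coordinates are independent and geometrically distributed: ${\bf Pr}[X_j=k]=(1-q_j)q_j^k$, $q_j\in[0,1)$. *)

theory Defs
  imports "HOL-Probability.Probability" "Jordan_Normal_Form.DL_Rank"
begin

no_notation vec_nth (infixl "$" 90)

definition nonneg_solutions :: "real mat \<Rightarrow> real Matrix.vec \<Rightarrow> real Matrix.vec set" where
  "nonneg_solutions A b =
    {x \<in> carrier_vec (dim_col A). (\<forall>j<dim_col A. 0 \<le> x $ j) \<and> A *\<^sub>v x = b}"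

definition integer_vecs :: "nat \<Rightarrow> real Matrix.vec set" where
  "integer_vecs n = {x \<in> carrier_vec n. \<forall>j<n. x $ j \<in> \<int>}"

text \<open>
  A random vector with values in the nonnegative integer vectors of dimension \<open>n\<close> is represented
  by its distribution, a \<open>pmf\<close> on \<open>nat vec\<close> supported on \<open>carrier_vec n\<close>.
\<close>

definition coord_mean :: "nat Matrix.vec pmf \<Rightarrow> nat \<Rightarrow> real" where
  "coord_mean X j = measure_pmf.expectation X (\<lambda>k. real (k $ j))"

text \<open>
  With natural logarithms. Since \<open>ln 0 = 0\<close> in HOL, atoms of probability 0 contribute 0.
  All terms are nonnegative, and \<open>finite_entropy\<close> says that their sum is finite
  (otherwise \<open>infsum\<close> returns 0).
\<close>

definition pmf_entropy :: "'a pmf \<Rightarrow> real" where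
  "pmf_entropy X = (\<Sum>\<^sub>\<infinity>k. - (pmf X k * ln (pmf X k)))"

definition finite_entropy :: "'a pmf \<Rightarrow> bool" where
  "finite_entropy X \<longleftrightarrow> (\<lambda>k. - (pmf X k * ln (pmf X k))) summable_on UNIV"

text \<open>
  \<open>mean_constraint A b X\<close>: \<open>X\<close> takes values in the nonnegative integer vectors of dimension
  \<open>dim_col A\<close>, the expectation of \<open>A X\<close> exists, and it equals \<open>b\<close>. Integrability is required
  explicitly because the Bochner integral of a non-integrable function is 0.
\<close>

definition mean_constraint :: "real mat \<Rightarrow> real Matrix.vec \<Rightarrow> nat Matrix.vec pmf \<Rightarrow> bool" where
  "mean_constraint A b X \<longleftrightarrow>
    set_pmf X \<subseteq> carrier_vec (dim_col A) \<and>
    (\<forall>i<dim_row A.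
       integrable (measure_pmf X) (\<lambda>k. (A *\<^sub>v map_vec real k) $ i) \<and>
       measure_pmf.expectation X (\<lambda>k. (A *\<^sub>v map_vec real k) $ i) = b $ i)"

text \<open>
  \<open>X\<close> attains the (finite) maximum of the entropy under the constraint; the conjunct
  \<open>finite_entropy Y\<close> is the comparison with a competitor \<open>Y\<close> of infinite entropy.
\<close>

definition max_entropy_vector :: "real mat \<Rightarrow> real Matrix.vec \<Rightarrow> nat Matrix.vec pmf \<Rightarrow> bool" where
  "max_entropy_vector A b X \<longleftrightarrow>
    mean_constraint A b X \<and> finite_entropy X \<and>
    (\<forall>Y. mean_constraint A b Y \<longrightarrow> finite_entropy Y \<and> pmf_entropy Y \<le> pmf_entropy X)"

text \<open>
  The factor of index \<open>i\<close> of the bound is \<open>0 powr (-1/2)\<close> when \<open>coord_mean X i < 1\<close>; the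
  mathematical value is then infinite, whereas \<open>powr\<close> returns 0. So \<open>entropy_bound\<close> is the
  intended bound only under \<open>bound_finite\<close>.
\<close>

definition entropy_bound :: "nat \<Rightarrow> nat \<Rightarrow> nat Matrix.vec pmf \<Rightarrow> real" where
  "entropy_bound m p X =
    exp (pmf_entropy X) *
    (\<Prod>i<m. (pi * real p / 6 * ((real_of_int \<lfloor>coord_mean X i + 1\<rfloor>)\<^sup>2 - 1)) powr (- 1 / 2))"

definition bound_finite :: "nat \<Rightarrow> nat Matrix.vec pmf \<Rightarrow> bool" where
  "bound_finite m X \<longleftrightarrow> (\<forall>i<m. (real_of_int \<lfloor>coord_mean X i + 1\<rfloor>)\<^sup>2 - 1 \<noteq> 0)"

end

theory Submission
  imports Defs
begin

text \<open>
  Since \<open>a\<^sub>1, \<dots>, a\<^sub>m\<close> is a basis, \<open>A x = b\<close> only says that for each \<open>i\<close> the block sum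
  \<open>x\<^sub>i + x\<^bsub>m+i\<^esub> + \<dots>\<close> equals the coordinate \<open>\<beta>\<^sub>i\<close> of \<open>b\<close>. Hence the number of lattice points is zero or
  the product of the binomial coefficients \<open>(N\<^sub>i + p - 1) choose N\<^sub>i\<close> with \<open>N\<^sub>i = \<beta>\<^sub>i\<close>, and by the equality case
  of Gibbs' inequality \<open>X\<close> has independent geometric coordinates of means \<open>\<mu>\<^sub>i = \<beta>\<^sub>i / p\<close>, so that
  \<open>exp (H(X))\<close> is the product of \<open>(N\<^sub>i + p)^(N\<^sub>i + p) / (N\<^sub>i^N\<^sub>i p^p)\<close>.
  A crude Stirling estimate gives \<open>(N + p - 1) choose N \<le> (N + p)^(N + p) / (N^N p^p) / sqrt (p \<mu> (\<mu> + 1))\<close>,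
  and \<open>\<pi>/6 ((\<mu> + 1)\<^sup>2 - 1) \<le> \<mu> (\<mu> + 1)\<close> for \<open>\<mu> \<ge> 1\<close>. So whenever the bound is finite it
  holds outright for each \<open>p\<close>, not only asymptotically.
\<close>

section \<open>Stirling-type estimates for multiset coefficients\<close>

text \<open>The logarithm of \<open>fact n\<close> divided by the Stirling main term
  \<open>sqrt n * (n / e) ^ n\<close>, without the constant \<open>sqrt (2 * pi)\<close>.\<close>

definition stirling_defect :: "nat \<Rightarrow> real" where
  "stirling_defect n = ln (fact n) + real n - (real n + 1 / 2) * ln (real n)"

lemma stirling_defect_diff:
  assumes "n \<ge> 1"
  shows "stirling_defect n - stirling_defect (Suc n) = (real n + 1 / 2) * (ln (real n + 1) - ln (real n)) - 1"
proof -
  have "ln (fact (Suc n) :: real) = ln (real n + 1) + ln (fact n)"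
    by (simp add: ln_mult add.commute)
  then show ?thesis
    by (simp add: stirling_defect_def algebra_simps)
qed

text \<open>By convexity of 1/x, its integral over [n, n + 1] is at least the value 2 / (2n + 1) at
  the midpoint. The factor n + 1/2 turns this into exactly 1.\<close>

lemma stirling_defect_Suc_le:
  assumes "n \<ge> 1"
  shows "stirling_defect (Suc n) \<le> stirling_defect n"
proof -
  have "2 / (2 * real n + 1) \<le> ln (real n + 1) - ln (real n)"
    using ln_inverse_approx_ge[of "real n" "real n + 1"] assms by simp
  then have "(real n + 1 / 2) * (2 / (2 * real n + 1)) \<le> (real n + 1 / 2) * (ln (real n + 1) - ln (real n))"
    by (intro mult_left_mono) auto
  moreover have "(real n + 1 / 2) * (2 / (2 * real n + 1)) = 1"
    by (simp add: field_simps)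
  ultimately show ?thesis
    using stirling_defect_diff[OF assms] by linarith
qed

lemma stirling_defect_antimono:
  assumes "1 \<le> n" "n \<le> k"
  shows "stirling_defect k \<le> stirling_defect n"
  using assms(2)
proof (induction k rule: dec_induct)
  case (step k)
  then show ?case
    using stirling_defect_Suc_le[of k] assms(1) by linarith
qed simp

text \<open>Dually, the trapezoid rule bounds the integral of 1/x from above, so each decrease of
  the defect is at most 1/(4n) - 1/(4(n + 1)). This telescopes, starting from the value 1 = 3/4 +
  1/4 at n = 1. The purpose is a positive lower bound.\<close>

lemma stirling_defect_ge:
  assumes "n \<ge> 1"
  shows "3 / 4 + 1 / (4 * real n) \<le> stirling_defect n"
  using assms
proof (induction n rule: dec_induct)
  case base
  then show ?case by (simp add: stirling_defect_def)
next
  case (step n)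
  have n: "real n > 0"
    using step.hyps by simp
  have "ln (real n + 1) - ln (real n) \<le> (inverse (real n) + inverse (real n + 1)) / 2"
    using ln_inverse_approx_le[of "real n" 1] n by simp
  then have "(real n + 1 / 2) * (ln (real n + 1) - ln (real n))
      \<le> (real n + 1 / 2) * ((inverse (real n) + inverse (real n + 1)) / 2)"
    by (intro mult_left_mono) auto
  also have "\<dots> = 1 + 1 / (4 * real n) - 1 / (4 * real (Suc n))"
    using n by (simp add: divide_simps) (simp add: algebra_simps)
  finally show ?case
    using stirling_defect_diff[of n] step by simp
qed

text \<open>In the logarithm of the coefficient the defects enter as d(N + p) - d(N) - d(p). This is
  at most 0, since d is decreasing and d(p) is nonnegative.\<close>

lemma multichoose_le_exp:
  assumes "N \<ge> 1" "p \<ge> 1"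
  defines "h \<equiv> real (N + p) * ln (real (N + p)) - real N * ln (real N) - real p * ln (real p)"
  shows "real ((N + p - 1) choose N) \<le> exp h * (real N * real (N + p) / real p) powr (- 1 / 2)"
proof -
  have pos: "real N > 0" "real p > 0" "real (N + p) > 0"
    using assms by auto
  have "N + p - 1 = N + (p - 1)"
    using assms by simp
  then have choose: "real ((N + p - 1) choose N) = fact (N + p - 1) / (fact N * fact (p - 1))"
    by (subst binomial_fact) auto
  have "ln (real ((N + p - 1) choose N)) = ln (fact (N + p - 1)) - ln (fact N) - ln (fact (p - 1))"
    unfolding choose by (simp add: ln_div ln_mult)
  \<comment> \<open>Passing to the factorials of \<open>N + p\<close> and \<open>p\<close> costs a
    factor p / (N + p); with the half powers from Stirling it combines to the square root in the
    bound.\<close>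
  also have "ln (fact (N + p - 1) :: real) = ln (fact (N + p)) - ln (real (N + p))"
    using fact_reduce[of "N + p", where 'a = real] pos by (simp add: ln_mult)
  also have "ln (fact (p - 1) :: real) = ln (fact p) - ln (real p)"
    using fact_reduce[of p, where 'a = real] pos by (simp add: ln_mult)
  finally have "ln (real ((N + p - 1) choose N)) = h - (ln (real N) + ln (real (N + p)) - ln (real p)) / 2
      + (stirling_defect (N + p) - stirling_defect N - stirling_defect p)"
    by (simp add: stirling_defect_def h_def field_simps)
  also have "\<dots> \<le> h - (ln (real N) + ln (real (N + p)) - ln (real p)) / 2"
  proof -
    have "0 \<le> 3 / 4 + 1 / (4 * real p)"
      by simp
    then have "0 \<le> stirling_defect p"
      using stirling_defect_ge[of p] assms(2) by linarith
    then show ?thesis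
      using stirling_defect_antimono[of N "N + p"] assms(1) by simp
  qed
  also have "\<dots> = ln (exp h * (real N * real (N + p) / real p) powr (- 1 / 2))"
    using pos by (simp add: ln_mult ln_powr ln_div del: of_nat_add)
  finally show ?thesis
    using pos assms by (subst (asm) ln_le_cancel_iff) (auto simp: zero_less_binomial_iff)
qed

text \<open>For \<mu> = N / p the quantity under the root in \<open>multichoose_le_exp\<close> is p
  \<mu> (\<mu> + 1). It dominates the one with the floor as soon as \<mu> is at least 1, and the
  exponent -1/2 reverses the inequality.\<close>

lemma multichoose_le_floor_bound:
  assumes "p \<ge> 1" and floor: "(real_of_int \<lfloor>real N / real p + 1\<rfloor>)\<^sup>2 - 1 \<noteq> 0"
  shows "real ((N + p - 1) choose N) \<le>
    exp (real (N + p) * ln (real (N + p)) - real N * ln (real N) - real p * ln (real p)) *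
    (pi * real p / 6 * ((real_of_int \<lfloor>real N / real p + 1\<rfloor>)\<^sup>2 - 1)) powr (- 1 / 2)"
proof -
  define \<mu> where "\<mu> = real N / real p"
  define f where "f = real_of_int \<lfloor>\<mu> + 1\<rfloor>"
  have p: "real p > 0"
    using assms by simp
  have \<mu>0: "\<mu> \<ge> 0"
    by (simp add: \<mu>_def)
  have "\<lfloor>\<mu> + 1\<rfloor> \<noteq> 1"
    using floor by (auto simp: \<mu>_def)
  moreover have "\<lfloor>\<mu> + 1\<rfloor> \<ge> 1"
    using \<mu>0 by linarith
  \<comment> \<open>A nonzero factor excludes the value 1 of the floor; this is what yields \<mu>
    \<ge> 1.\<close>
  ultimately have f2: "f \<ge> 2"
    unfolding f_def by linarith
  have f_le: "f \<le> \<mu> + 1"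
    by (simp add: f_def)
  have \<mu>: "\<mu> \<ge> 1"
    using f2 f_le by simp
  have N: "N \<ge> 1"
    using \<mu> by (cases N) (auto simp: \<mu>_def)
  have fsq: "f\<^sup>2 - 1 \<le> \<mu> * (\<mu> + 2)"
    using power_mono[OF f_le, of 2] f2 by (simp add: power2_eq_square algebra_simps)
  have fpos: "f\<^sup>2 - 1 > 0"
    using power_mono[OF f2, of 2] by simp
  \<comment> \<open>The crude bound pi < 4 suffices: 2/3 (\<mu> + 2) \<le> \<mu> + 1 is equivalent
    to \<mu> \<ge> 1.\<close>
  have "pi * real p / 6 * (f\<^sup>2 - 1) \<le> 4 * real p / 6 * (\<mu> * (\<mu> + 2))"
    using pi_less_4 p fpos fsq by (intro mult_mono) auto
  also have "\<dots> = real p * \<mu> * (2 / 3 * (\<mu> + 2))"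
    by simp
  also have "\<dots> \<le> real p * \<mu> * (\<mu> + 1)"
    using \<mu> p by (intro mult_left_mono) auto
  also have "\<dots> = real N * real (N + p) / real p"
    using p by (simp add: \<mu>_def field_simps)
  finally have "(real N * real (N + p) / real p) powr (- 1 / 2) \<le> (pi * real p / 6 * (f\<^sup>2 - 1)) powr (- 1 / 2)"
    using p fpos by (intro powr_mono2') auto
  then show ?thesis
    using multichoose_le_exp[OF N assms(1)] unfolding f_def \<mu>_def
    by (meson exp_ge_zero mult_left_mono order_trans)
qed

section \<open>Entropy and the equality case of Gibbs' inequality\<close>

text \<open>Links Bochner expectations, used for the means, with the unordered sums that define the
  entropy.\<close>

lemma has_sum_expectation_pmf:
  fixes f :: "'a \<Rightarrow> real"
  assumes "integrable (measure_pmf X) f"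
  shows "((\<lambda>k. pmf X k * f k) has_sum measure_pmf.expectation X f) UNIV"
proof -
  have "integrable (count_space UNIV) (\<lambda>k. pmf X k * f k)"
    using assms by (simp add: measure_pmf_eq_density integrable_density)
  then have abs: "Infinite_Set_Sum.abs_summable_on (\<lambda>k. pmf X k * f k) UNIV"
    by (simp add: Infinite_Set_Sum.abs_summable_on_def)
  have "measure_pmf.expectation X f = infsum (\<lambda>k. pmf X k * f k) UNIV"
    by (simp add: pmf_expectation_eq_infsetsum infsetsum_infsum[OF abs])
  moreover have "(\<lambda>k. pmf X k * f k) summable_on UNIV"
    using abs unfolding abs_summable_equivalent[symmetric] by (rule abs_summable_summable)
  ultimately show ?thesis
    by (simp add: has_sum_infsum)
qed

lemma has_sum_pmf: "(pmf X has_sum 1) UNIV"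
  using has_sum_expectation_pmf[of X "\<lambda>_. 1"] by simp

lemma pmf_entropy_eq_expectation:
  assumes "integrable (measure_pmf X) (\<lambda>k. - ln (pmf X k))"
  shows "pmf_entropy X = measure_pmf.expectation X (\<lambda>k. - ln (pmf X k))"
  unfolding pmf_entropy_def using infsumI[OF has_sum_expectation_pmf[OF assms]] by simp

text \<open>For x > 0 the expression is x (z - 1 - ln z) with z = y / x, and ln z \<le> z - 1 with
  equality only at z = 1. For x = 0 it is y. The summand y - x, of total 0 for two distributions,
  makes every single term of the relative entropy nonnegative.\<close>

lemma relative_entropy_term:
  fixes x y :: real
  assumes "x \<ge> 0" "y > 0"
  shows "0 \<le> y - x + x * (ln x - ln y)"
    and "y - x + x * (ln x - ln y) = 0 \<Longrightarrow> x = y"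
proof -
  have *: "x * (y / x - 1 - ln (y / x)) = y - x + x * (ln x - ln y)" if "x > 0"
    using that assms by (simp add: ln_div field_simps)
  show "0 \<le> y - x + x * (ln x - ln y)"
  proof (cases "x = 0")
    case False
    then show ?thesis
      using * assms ln_le_minus_one[of "y / x"] by (smt (verit) divide_pos_pos mult_nonneg_nonneg)
  qed (use assms in auto)
  show "x = y" if "y - x + x * (ln x - ln y) = 0"
  proof (cases "x = 0")
    case False
    then have "ln (y / x) = y / x - 1"
      using * that assms by (smt (verit) mult_eq_0_iff)
    then have "y / x = 1"
      using False assms by (intro ln_eq_minus_one) auto
    then show ?thesis
      using False by simp
  qed (use that assms in auto)
qed

text \<open>The terms \<open>t k\<close> are nonnegative and sum to the cross entropy minus the
  entropy of \<open>X\<close>, which is at most 0. Hence each vanishes, and the masses agree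
  pointwise.\<close>

lemma pmf_eq_of_cross_entropy_le:
  assumes "set_pmf X \<subseteq> set_pmf Y" "finite_entropy X"
    and int: "integrable (measure_pmf X) (\<lambda>k. - ln (pmf Y k))"
    and le: "measure_pmf.expectation X (\<lambda>k. - ln (pmf Y k)) \<le> pmf_entropy X"
  shows "X = Y"
proof -
  define t where "t k = pmf Y k - pmf X k + pmf X k * (ln (pmf X k) - ln (pmf Y k))" for k
  have "((\<lambda>k. - (pmf X k * ln (pmf X k))) has_sum pmf_entropy X) UNIV"
    using assms(2) unfolding finite_entropy_def pmf_entropy_def by (rule has_sum_infsum)
  then have "((\<lambda>k. (pmf Y k + - pmf X k) + (pmf X k * - ln (pmf Y k) + - (- (pmf X k * ln (pmf X k))))) has_sum
      (1 + - 1) + (measure_pmf.expectation X (\<lambda>k. - ln (pmf Y k)) + - pmf_entropy X)) UNIV"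
    by (intro has_sum_add has_sum_pmf has_sum_uminusI has_sum_expectation_pmf[OF int]) auto
  moreover have "(\<lambda>k. (pmf Y k + - pmf X k) + (pmf X k * - ln (pmf Y k) + - (- (pmf X k * ln (pmf X k))))) = t"
    by (auto simp: t_def algebra_simps)
  ultimately have t: "(t has_sum (measure_pmf.expectation X (\<lambda>k. - ln (pmf Y k)) - pmf_entropy X)) UNIV"
    by simp
  \<comment> \<open>Outside the support of \<open>Y\<close> the mass of \<open>X\<close> vanishes as
    well, so the default value \<open>ln 0 = 0\<close> does no harm.\<close>
  have zero: "pmf X k = 0" if "\<not> pmf Y k > 0" for k
    using that assms(1) by (metis subsetD set_pmf_iff pmf_positive)
  have nonneg: "0 \<le> t k" for k
    using relative_entropy_term(1)[of "pmf X k" "pmf Y k"] zero[of k]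
    by (cases "pmf Y k > 0") (auto simp: t_def)
  have "t k = 0" for k
    using nonneg_infsum_le_0D[of t UNIV k] t le nonneg
    by (auto simp: infsumI summable_on_def)
  then have "pmf X k = pmf Y k" for k
    using relative_entropy_term(2)[of "pmf X k" "pmf Y k"] zero[of k]
    by (cases "pmf Y k > 0") (auto simp: t_def not_less intro: antisym)
  then show ?thesis
    by (rule pmf_eqI)
qed

section \<open>Reduction of the linear system to block sums\<close>

text \<open>Indices start at 0: coordinate \<open>t * m + i\<close> belongs to copy \<open>t\<close>
  of the basis column \<open>i\<close>. The type is general because lattice points are real vectors
  while the random vector has natural entries.\<close>

definition block_sum :: "nat \<Rightarrow> nat \<Rightarrow> 'a::comm_monoid_add Matrix.vec \<Rightarrow> nat \<Rightarrow> 'a" where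
  "block_sum m p x i = (\<Sum>t<p. x $ (t * m + i))"

lemma block_index_less:
  fixes t p i m :: nat
  assumes "t < p" "i < m"
  shows "t * m + i < p * m"
proof -
  have "t * m + i < Suc t * m"
    using assms by simp
  also have "\<dots> \<le> p * m"
    using assms by (intro mult_le_mono1) simp
  finally show ?thesis .
qed

lemma sum_blocks:
  fixes f :: "nat \<Rightarrow> 'a::comm_monoid_add"
  shows "(\<Sum>j<p * m. f j) = (\<Sum>i<m. \<Sum>t<p. f (t * m + i))"
proof -
  have "(\<Sum>j<p * m. f j) = (\<Sum>t<p. \<Sum>i<m. f (t * m + i))"
    unfolding sum.nat_group[symmetric]
    by (simp add: sum.atLeastLessThan_shift_0 comp_def atLeast0LessThan)
  then show ?thesis
    by (simp add: sum.swap[of _ "{..<m}"])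
qed

lemma block_sum_map_vec_real:
  assumes "k \<in> carrier_vec (p * m)" "i < m"
  shows "block_sum m p (map_vec real k) i = real (block_sum m p k i)"
  using assms block_index_less[OF _ assms(2)] by (auto simp: block_sum_def intro!: sum.cong)

text \<open>A square matrix with distinct, linearly independent columns has full rank, hence nonzero
  determinant, hence a two-sided inverse.\<close>

lemma basis_columns_inverse:
  fixes a :: "nat \<Rightarrow> real Matrix.vec"
  assumes "vectorspace.basis class_ring (module_vec TYPE(real) m) (a ` {..<m})"
  obtains B C where "B \<in> carrier_mat m m" "C \<in> carrier_mat m m" "B * C = 1\<^sub>m m" "C * B = 1\<^sub>m m"
    "\<And>i. i < m \<Longrightarrow> col B i = a i"
proof -
  interpret vec_space "TYPE(real)" m .
  have li: "lin_indpt (a ` {..<m})" and car: "a ` {..<m} \<subseteq> carrier_vec m"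
    using assms unfolding basis_def by auto
  \<comment> \<open>The basis is given as a set; comparing its cardinality with the dimension rules
    out repetitions among the \<open>a i\<close>.\<close>
  have "card (a ` {..<m}) = m"
    using dim_basis[OF _ assms] dim_is_n by simp
  then have inj: "inj_on a {..<m}"
    by (intro eq_card_imp_inj_on) auto
  define B where "B = mat_of_cols m (map a [0..<m])"
  have B: "B \<in> carrier_mat m m"
    unfolding B_def using mat_of_cols_carrier(1)[of m "map a [0..<m]"] by simp
  have cols: "cols B = map a [0..<m]"
    unfolding B_def using car by (intro cols_mat_of_cols) auto
  have "rank B = m"
  proof (rule lin_indpt_full_rank[OF B])
    show "distinct (cols B)"
      using inj by (simp add: cols distinct_map atLeast0LessThan)
    show "lin_indpt (set (cols B))"
      using li by (simp add: cols atLeast0LessThan)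
  qed
  then have "det B \<noteq> 0"
    using det_rank_iff[OF B] by simp
  from det_non_zero_imp_unit[OF B this, of "()"]
  obtain C where C: "C \<in> carrier_mat m m" "C * B = 1\<^sub>m m" "B * C = 1\<^sub>m m"
    by (auto simp: Units_def ring_mat_def)
  have "col B i = a i" if "i < m" for i
    using that cols B by (metis carrier_matD(2) cols_nth length_upt minus_nat.diff_0 nth_map nth_upt add_0)
  then show ?thesis
    using that[of B C] B C by blast
qed

lemma mult_mat_vec_blocks:
  fixes A B :: "real mat"
  assumes A: "A \<in> carrier_mat m (p * m)" and B: "B \<in> carrier_mat m m"
    and cols: "\<forall>i<m. \<forall>t<p. col A (t * m + i) = col B i"
    and x: "x \<in> carrier_vec (p * m)" and r: "r < m"
  shows "(A *\<^sub>v x) $ r = (\<Sum>i<m. B $$ (r, i) * block_sum m p x i)"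
proof -
  have "(A *\<^sub>v x) $ r = (\<Sum>j<p * m. A $$ (r, j) * x $ j)"
    using A x r by (simp add: scalar_prod_def row_def atLeast0LessThan)
  also have "\<dots> = (\<Sum>i<m. \<Sum>t<p. A $$ (r, t * m + i) * x $ (t * m + i))"
    by (rule sum_blocks)
  also have "\<dots> = (\<Sum>i<m. \<Sum>t<p. B $$ (r, i) * x $ (t * m + i))"
  proof (intro sum.cong refl)
    fix i t assume it: "i \<in> {..<m}" "t \<in> {..<p}"
    then have "A $$ (r, t * m + i) = col A (t * m + i) $ r"
      using A r block_index_less[of t p i m] by (subst index_col) auto
    also have "\<dots> = B $$ (r, i)"
      using it B r cols by simp
    finally show "A $$ (r, t * m + i) * x $ (t * m + i) = B $$ (r, i) * x $ (t * m + i)"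
      by simp
  qed
  finally show ?thesis
    by (simp add: block_sum_def sum_distrib_left)
qed

text \<open>Collecting equal columns gives \<open>A x = B s\<close> for the vector \<open>s\<close>
  of block sums, and \<open>C\<close> undoes \<open>B\<close>.\<close>

lemma block_sum_eq_mult_mat_vec:
  fixes A B C :: "real mat"
  assumes A: "A \<in> carrier_mat m (p * m)" and B: "B \<in> carrier_mat m m" and C: "C \<in> carrier_mat m m"
    and CB: "C * B = 1\<^sub>m m"
    and cols: "\<forall>i<m. \<forall>t<p. col A (t * m + i) = col B i"
    and x: "x \<in> carrier_vec (p * m)" and i: "i < m"
  shows "block_sum m p x i = (C *\<^sub>v (A *\<^sub>v x)) $ i"
proof -
  define s where "s = Matrix.vec m (block_sum m p x)"
  have s: "s \<in> carrier_vec m"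
    by (simp add: s_def)
  have "A *\<^sub>v x = B *\<^sub>v s"
  proof (rule eq_vecI)
    fix r assume "r < dim_vec (B *\<^sub>v s)"
    then have "r < m"
      using B by simp
    then show "(A *\<^sub>v x) $ r = (B *\<^sub>v s) $ r"
      using mult_mat_vec_blocks[OF A B cols x] B
      by (simp add: scalar_prod_def s_def atLeast0LessThan)
  qed (use A B in auto)
  then have "C *\<^sub>v (A *\<^sub>v x) = (C * B) *\<^sub>v s"
    using B C s by simp
  then show ?thesis
    using i s by (simp add: CB s_def)
qed

text \<open>On the support the coordinates of \<open>A k\<close> and the block sums of
  \<open>k\<close> are linear combinations of each other, with coefficients from \<open>B\<close>
  and \<open>C\<close>. Integrability and means therefore transfer in both directions.\<close>

lemma mean_constraint_iff_block:
  fixes A B C :: "real mat"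
  assumes A: "A \<in> carrier_mat m (p * m)" and B: "B \<in> carrier_mat m m" and C: "C \<in> carrier_mat m m"
    and BC: "B * C = 1\<^sub>m m" and CB: "C * B = 1\<^sub>m m"
    and cols: "\<forall>i<m. \<forall>t<p. col A (t * m + i) = col B i"
    and b: "b \<in> carrier_vec m"
  shows "mean_constraint A b Z \<longleftrightarrow> set_pmf Z \<subseteq> carrier_vec (p * m) \<and>
    (\<forall>i<m. integrable (measure_pmf Z) (\<lambda>k. real (block_sum m p k i)) \<and>
      measure_pmf.expectation Z (\<lambda>k. real (block_sum m p k i)) = (C *\<^sub>v b) $ i)"
proof (cases "set_pmf Z \<subseteq> carrier_vec (p * m)")
  case False
  then show ?thesis
    using A by (auto simp: mean_constraint_def)
next
  case True
  let ?f = "\<lambda>r k. (A *\<^sub>v map_vec real k) $ r"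
  let ?s = "\<lambda>i k. real (block_sum m p k i)"
  have f: "?f r k = (\<Sum>i<m. B $$ (r, i) * ?s i k)" if "k \<in> set_pmf Z" "r < m" for r k
    using mult_mat_vec_blocks[OF A B cols, of "map_vec real k" r] that True
    by (auto simp: block_sum_map_vec_real subset_iff)
  have s: "?s i k = (\<Sum>r<m. C $$ (i, r) * ?f r k)" if "k \<in> set_pmf Z" "i < m" for i k
  proof -
    have "?s i k = (C *\<^sub>v (A *\<^sub>v map_vec real k)) $ i"
      using block_sum_eq_mult_mat_vec[OF A B C CB cols, of "map_vec real k" i] that True
      by (auto simp: block_sum_map_vec_real subset_iff)
    then show ?thesis
      using C A that by (simp add: scalar_prod_def atLeast0LessThan)
  qed
  have Cb: "(C *\<^sub>v b) $ i = (\<Sum>r<m. C $$ (i, r) * b $ r)" if "i < m" for i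
    using that C b by (simp add: scalar_prod_def atLeast0LessThan)
  have BCb: "B *\<^sub>v (C *\<^sub>v b) = b"
    using B C b BC by (metis assoc_mult_mat_vec one_mult_mat_vec)
  have bB: "b $ r = (\<Sum>i<m. B $$ (r, i) * (C *\<^sub>v b) $ i)" if "r < m" for r
  proof -
    have "(B *\<^sub>v (C *\<^sub>v b)) $ r = (\<Sum>i<m. B $$ (r, i) * (C *\<^sub>v b) $ i)"
      using that B C by (simp add: scalar_prod_def[of _ "C *\<^sub>v b"] atLeast0LessThan)
    then show ?thesis
      by (simp add: BCb)
  qed
  show ?thesis
  proof (intro iffI conjI allI impI)
    fix i assume mc: "mean_constraint A b Z" and i: "i < m"
    then have int: "integrable (measure_pmf Z) (?f r)" "measure_pmf.expectation Z (?f r) = b $ r"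
      if "r < m" for r
      using that A unfolding mean_constraint_def by auto
    \<comment> \<open>The linear identity needs a vector of the right dimension, so it is available
      on the support only, that is, almost everywhere.\<close>
    have cong: "AE k in measure_pmf Z. ?s i k = (\<Sum>r<m. C $$ (i, r) * ?f r k)"
      using s i by (simp add: AE_measure_pmf_iff)
    show "integrable (measure_pmf Z) (?s i)"
      by (subst integrable_cong_AE[OF _ _ cong]) (auto intro!: Bochner_Integration.integrable_sum int)
    have "measure_pmf.expectation Z (?s i) = measure_pmf.expectation Z (\<lambda>k. \<Sum>r<m. C $$ (i, r) * ?f r k)"
      by (rule integral_cong_AE[OF _ _ cong]) auto
    also have "\<dots> = (\<Sum>r<m. C $$ (i, r) * b $ r)"
      using int by (subst Bochner_Integration.integral_sum) auto
    finally show "measure_pmf.expectation Z (?s i) = (C *\<^sub>v b) $ i"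
      using Cb i by simp
  next
    assume "set_pmf Z \<subseteq> carrier_vec (p * m) \<and> (\<forall>i<m. integrable (measure_pmf Z) (?s i) \<and>
      measure_pmf.expectation Z (?s i) = (C *\<^sub>v b) $ i)"
    then have int: "integrable (measure_pmf Z) (?s i)" "measure_pmf.expectation Z (?s i) = (C *\<^sub>v b) $ i"
      if "i < m" for i
      using that by auto
    have cong: "AE k in measure_pmf Z. ?f r k = (\<Sum>i<m. B $$ (r, i) * ?s i k)" if "r < m" for r
      using f that by (simp add: AE_measure_pmf_iff)
    have "integrable (measure_pmf Z) (?f r)" if "r < m" for r
      by (subst integrable_cong_AE[OF _ _ cong[OF that]]) (auto intro!: Bochner_Integration.integrable_sum int)
    moreover have "measure_pmf.expectation Z (?f r) = b $ r" if "r < m" for r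
    proof -
      have "measure_pmf.expectation Z (?f r) = measure_pmf.expectation Z (\<lambda>k. \<Sum>i<m. B $$ (r, i) * ?s i k)"
        by (rule integral_cong_AE[OF _ _ cong[OF that]]) auto
      also have "\<dots> = (\<Sum>i<m. B $$ (r, i) * (C *\<^sub>v b) $ i)"
        using int by (subst Bochner_Integration.integral_sum) auto
      finally show ?thesis
        using bB that by simp
    qed
    ultimately show "mean_constraint A b Z"
      using True A unfolding mean_constraint_def by auto
  qed (use True in auto)
qed

section \<open>Counting lattice points\<close>

text \<open>The map \<open>\<phi>\<close> cuts a solution into one list of length \<open>p\<close>
  and sum \<open>N i\<close> for each block. It is injective, and such lists are counted by stars
  and bars.\<close>

lemma card_block_solutions_le:
  assumes sol: "\<And>x. x \<in> S \<Longrightarrow> x \<in> carrier_vec (p * m) \<and> (\<forall>j<p * m. 0 \<le> x $ j \<and> x $ j \<in> \<int>) \<and>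
      (\<forall>i<m. block_sum m p x i = real (N i))"
  shows "card (S :: real Matrix.vec set) \<le> (\<Prod>i<m. (N i + p - 1) choose (N i))"
proof -
  define L where "L i = {l :: nat list. length l = p \<and> sum_list l = N i}" for i
  define \<phi> where "\<phi> x = (\<lambda>i\<in>{..<m}. map (\<lambda>t. nat \<lfloor>x $ (t * m + i)\<rfloor>) [0..<p])" for x :: "real Matrix.vec"
  have card_L: "card (L i) = (N i + p - 1) choose (N i)" for i
    unfolding L_def by (rule card_length_sum_list)
  have fin: "finite (L i)" for i
  proof -
    have "L i \<subseteq> {l. set l \<subseteq> {..N i} \<and> length l = p}"
      unfolding L_def using member_le_sum_list by fastforce
    then show ?thesis
      by (rule finite_subset) (simp add: finite_lists_length_eq)
  qed
  \<comment> \<open>Entries are nonnegative integers, so rounding to natural numbers loses nothing;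
    both the sums and the injectivity rest on this.\<close>
  have entry: "real (nat \<lfloor>x $ (t * m + i)\<rfloor>) = x $ (t * m + i)" if "x \<in> S" "i < m" "t < p" for x i t
    using sol[OF that(1)] block_index_less[OF that(3,2)] by (auto elim!: Ints_cases)
  have "\<phi> x \<in> Pi\<^sub>E {..<m} L" if x: "x \<in> S" for x
  proof
    fix i assume i: "i \<in> {..<m}"
    have "real (\<Sum>t<p. nat \<lfloor>x $ (t * m + i)\<rfloor>) = (\<Sum>t<p. x $ (t * m + i))"
      using entry[OF x] i by simp
    also have "\<dots> = real (N i)"
      using sol[OF x] i by (simp add: block_sum_def)
    finally have "(\<Sum>t<p. nat \<lfloor>x $ (t * m + i)\<rfloor>) = N i"
      using of_nat_eq_iff by blast
    then show "\<phi> x i \<in> L i"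
      using i by (simp add: \<phi>_def L_def interv_sum_list_conv_sum_set_nat atLeast0LessThan)
  qed (simp add: \<phi>_def)
  moreover have "inj_on \<phi> S"
  proof (rule inj_onI)
    fix x y assume x: "x \<in> S" and y: "y \<in> S" and eq: "\<phi> x = \<phi> y"
    show "x = y"
    proof (rule eq_vecI)
      show "dim_vec x = dim_vec y"
        using sol[OF x] sol[OF y] by auto
      fix j assume "j < dim_vec y"
      then have j: "j < p * m"
        using sol[OF y] by auto
      define i where "i = j mod m"
      define t where "t = j div m"
      have "m > 0"
        using j by (cases m) auto
      then have it: "i < m" "t < p" "j = t * m + i"
        using j by (auto simp: i_def t_def less_mult_imp_div_less)
      have "\<phi> x i ! t = \<phi> y i ! t"
        using eq by simp
      then have "nat \<lfloor>x $ j\<rfloor> = nat \<lfloor>y $ j\<rfloor>"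
        using it by (simp add: \<phi>_def)
      then show "x $ j = y $ j"
        using entry[OF x it(1,2)] entry[OF y it(1,2)] unfolding it(3)[symmetric] by metis
    qed
  qed
  ultimately have "card S \<le> card (Pi\<^sub>E {..<m} L)"
    using fin by (intro card_inj_on_le[of \<phi>]) (auto intro: finite_PiE)
  also have "\<dots> = (\<Prod>i<m. (N i + p - 1) choose (N i))"
    by (simp add: card_PiE card_L)
  finally show ?thesis .
qed

section \<open>The vector of independent geometric coordinates\<close>

text \<open>Here \<open>j mod m\<close> is the block of coordinate \<open>j\<close>, and
  \<open>\<beta> i\<close> is the prescribed mean of block sum \<open>i\<close>. A geometric law
  with success probability r has mean (1 - r) / r, so the chosen parameter gives each coordinate the
  mean \<beta> / p.\<close>

definition geometric_vec_pmf :: "nat \<Rightarrow> nat \<Rightarrow> (nat \<Rightarrow> real) \<Rightarrow> nat Matrix.vec pmf" where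
  "geometric_vec_pmf m p \<beta> = map_pmf (Matrix.vec (p * m))
     (Pi_pmf {..<p * m} 0 (\<lambda>j. geometric_pmf (real p / (real p + \<beta> (j mod m)))))"

lemma set_geometric_vec_pmf_subset: "set_pmf (geometric_vec_pmf m p \<beta>) \<subseteq> carrier_vec (p * m)"
  by (auto simp: geometric_vec_pmf_def)

lemma pmf_geometric_vec_pmf:
  assumes "p > 0" "\<forall>i<m. \<beta> i > 0" and k: "k \<in> carrier_vec (p * m)"
  shows "pmf (geometric_vec_pmf m p \<beta>) k =
    (\<Prod>j<p * m. (\<beta> (j mod m) / (real p + \<beta> (j mod m))) ^ (k $ j) * (real p / (real p + \<beta> (j mod m))))"
proof -
  let ?D = "\<lambda>j. geometric_pmf (real p / (real p + \<beta> (j mod m)))"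
  let ?P = "Pi_pmf {..<p * m} 0 ?D"
  \<comment> \<open>The extension of \<open>k\<close> by the default value 0 of
    \<open>Pi_pmf\<close> is the only preimage of \<open>k\<close> in the support.\<close>
  define f where "f j = (if j < p * m then k $ j else 0)" for j
  have vec_f: "Matrix.vec (p * m) f = k"
    using k by (intro eq_vecI) (auto simp: f_def)
  have \<beta>: "\<beta> (j mod m) > 0" if "j < p * m" for j
    using that assms(2) by (cases m) auto
  have pmf_D: "pmf (?D j) t = (\<beta> (j mod m) / (real p + \<beta> (j mod m))) ^ t * (real p / (real p + \<beta> (j mod m)))"
    if "j < p * m" for j t
  proof -
    have "1 - real p / (real p + \<beta> (j mod m)) = \<beta> (j mod m) / (real p + \<beta> (j mod m))"
      using \<beta>[OF that] assms(1) by (simp add: field_simps)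
    then show ?thesis
      using \<beta>[OF that] assms(1) by (subst pmf_geometric) auto
  qed
  have pmf_f: "pmf ?P f = (\<Prod>j<p * m. pmf (?D j) (k $ j))"
    by (subst pmf_Pi') (auto simp: f_def)
  have "pmf (map_pmf (Matrix.vec (p * m)) ?P) (Matrix.vec (p * m) f) = pmf ?P f"
  proof (rule pmf_map_inj)
    \<comment> \<open>\<open>Matrix.vec\<close> forgets the values from index \<open>p * m\<close>
      on, but in the support these all equal the default 0.\<close>
    show "inj_on (Matrix.vec (p * m)) (set_pmf ?P)"
    proof (rule inj_onI)
      fix g h assume gh: "g \<in> set_pmf ?P" "h \<in> set_pmf ?P" "Matrix.vec (p * m) g = Matrix.vec (p * m) h"
      have "g j = h j" for j
      proof (cases "j < p * m")
        case True
        then show ?thesis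
          using gh(3) by (metis index_vec)
      next
        case False
        then show ?thesis
          using subsetD[OF set_Pi_pmf_subset gh(1)] subsetD[OF set_Pi_pmf_subset gh(2)] by simp
      qed
      then show "g = h" ..
    qed
    have "pmf ?P f > 0"
      unfolding pmf_f using \<beta> assms(1) by (intro prod_pos) (auto simp: pmf_D add_pos_pos)
    then show "f \<in> set_pmf ?P"
      by (simp add: set_pmf_iff)
  qed
  then show ?thesis
    by (simp add: geometric_vec_pmf_def vec_f pmf_f pmf_D)
qed

text \<open>All coordinates of a block share one parameter, so their exponents add up to the block
  sum. Full support and this form are what the comparison by cross entropy needs.\<close>

lemma ln_pmf_geometric_vec_pmf:
  assumes "p > 0" "\<forall>i<m. \<beta> i > 0" and k: "k \<in> carrier_vec (p * m)"
  shows "pmf (geometric_vec_pmf m p \<beta>) k > 0"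
    and "ln (pmf (geometric_vec_pmf m p \<beta>) k) =
      (\<Sum>i<m. real (block_sum m p k i) * ln (\<beta> i / (real p + \<beta> i)) + real p * ln (real p / (real p + \<beta> i)))"
proof -
  have \<beta>: "\<beta> (j mod m) > 0" if "j < p * m" for j
    using that assms(2) by (cases m) auto
  have factor_pos: "0 < (\<beta> (j mod m) / (real p + \<beta> (j mod m))) ^ (k $ j) * (real p / (real p + \<beta> (j mod m)))"
    if "j < p * m" for j
    using \<beta>[OF that] assms(1) by (simp add: add_pos_pos)
  show "pmf (geometric_vec_pmf m p \<beta>) k > 0"
    unfolding pmf_geometric_vec_pmf[OF assms] using factor_pos by (intro prod_pos) blast
  have "ln (pmf (geometric_vec_pmf m p \<beta>) k) =
      (\<Sum>j<p * m. ln ((\<beta> (j mod m) / (real p + \<beta> (j mod m))) ^ (k $ j) * (real p / (real p + \<beta> (j mod m)))))"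
    unfolding pmf_geometric_vec_pmf[OF assms]
    by (rule ln_prod[OF finite_lessThan]) (metis factor_pos lessThan_iff less_irrefl)
  also have "\<dots> = (\<Sum>j<p * m. real (k $ j) * ln (\<beta> (j mod m) / (real p + \<beta> (j mod m)))
      + ln (real p / (real p + \<beta> (j mod m))))"
  proof (intro sum.cong refl)
    fix j assume "j \<in> {..<p * m}"
    then have "\<beta> (j mod m) > 0"
      using \<beta> by simp
    then have "\<beta> (j mod m) / (real p + \<beta> (j mod m)) > 0" "real p / (real p + \<beta> (j mod m)) > 0"
      using assms(1) by (simp_all add: add_pos_pos)
    then show "ln ((\<beta> (j mod m) / (real p + \<beta> (j mod m))) ^ (k $ j) * (real p / (real p + \<beta> (j mod m))))
      = real (k $ j) * ln (\<beta> (j mod m) / (real p + \<beta> (j mod m))) + ln (real p / (real p + \<beta> (j mod m)))"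
      by (simp only: ln_mult_pos[OF zero_less_power] ln_realpow)
  qed
  also have "\<dots> = (\<Sum>i<m. real (block_sum m p k i) * ln (\<beta> i / (real p + \<beta> i)) + real p * ln (real p / (real p + \<beta> i)))"
    unfolding sum_blocks
    by (intro sum.cong refl) (simp add: sum.distrib block_sum_def sum_distrib_right)
  finally show "ln (pmf (geometric_vec_pmf m p \<beta>) k) =
      (\<Sum>i<m. real (block_sum m p k i) * ln (\<beta> i / (real p + \<beta> i)) + real p * ln (real p / (real p + \<beta> i)))" .
qed

lemma geometric_vec_pmf_coord:
  assumes "p > 0" "\<forall>i<m. \<beta> i > 0" and j: "j < p * m"
  shows "integrable (measure_pmf (geometric_vec_pmf m p \<beta>)) (\<lambda>k. real (k $ j))"
    and "coord_mean (geometric_vec_pmf m p \<beta>) j = \<beta> (j mod m) / real p"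
proof -
  let ?\<rho> = "\<lambda>j. real p / (real p + \<beta> (j mod m))"
  let ?P = "Pi_pmf {..<p * m} 0 (\<lambda>j. geometric_pmf (?\<rho> j))"
  have \<beta>: "\<beta> (j mod m) > 0"
    using j assms(2) by (cases m) auto
  have \<rho>: "?\<rho> j \<in> {0<..1}"
    using \<beta> assms(1) by simp
  have "map_pmf (\<lambda>k. k $ j) (geometric_vec_pmf m p \<beta>) = map_pmf (\<lambda>f. f j) ?P"
    using j by (simp add: geometric_vec_pmf_def map_pmf_comp)
  also have "\<dots> = geometric_pmf (?\<rho> j)"
    using j by (subst Pi_pmf_component) auto
  finally have marginal: "map_pmf (\<lambda>k. k $ j) (geometric_vec_pmf m p \<beta>) = geometric_pmf (?\<rho> j)" .
  have "integrable (measure_pmf (map_pmf (\<lambda>k. k $ j) (geometric_vec_pmf m p \<beta>))) real"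
    unfolding marginal using \<rho> by (rule integrable_real_geometric_pmf)
  then show "integrable (measure_pmf (geometric_vec_pmf m p \<beta>)) (\<lambda>k. real (k $ j))"
    by simp
  have "coord_mean (geometric_vec_pmf m p \<beta>) j =
      measure_pmf.expectation (map_pmf (\<lambda>k. k $ j) (geometric_vec_pmf m p \<beta>)) real"
    by (simp add: coord_mean_def)
  also have "\<dots> = (1 - ?\<rho> j) / ?\<rho> j"
    unfolding marginal using \<rho> by (rule expectation_geometric_pmf)
  also have "\<dots> = \<beta> (j mod m) / real p"
    using \<beta> assms(1) by (simp add: divide_simps)
  finally show "coord_mean (geometric_vec_pmf m p \<beta>) j = \<beta> (j mod m) / real p" .
qed

lemma geometric_vec_pmf_block_sum:
  assumes "p > 0" "\<forall>i<m. \<beta> i > 0" and i: "i < m"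
  shows "integrable (measure_pmf (geometric_vec_pmf m p \<beta>)) (\<lambda>k. real (block_sum m p k i))"
    and "measure_pmf.expectation (geometric_vec_pmf m p \<beta>) (\<lambda>k. real (block_sum m p k i)) = \<beta> i"
proof -
  let ?Y = "geometric_vec_pmf m p \<beta>"
  have int: "integrable (measure_pmf ?Y) (\<lambda>k. real (k $ (t * m + i)))"
    and E: "measure_pmf.expectation ?Y (\<lambda>k. real (k $ (t * m + i))) = \<beta> i / real p" if "t < p" for t
    using geometric_vec_pmf_coord[OF assms(1,2) block_index_less[OF that i]] i by (auto simp: coord_mean_def)
  show "integrable (measure_pmf ?Y) (\<lambda>k. real (block_sum m p k i))"
    by (auto simp: block_sum_def intro!: Bochner_Integration.integrable_sum int)
  show "measure_pmf.expectation ?Y (\<lambda>k. real (block_sum m p k i)) = \<beta> i"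
    using int assms(1) by (simp add: block_sum_def Bochner_Integration.integral_sum E)
qed

text \<open>The cross entropy against the geometric vector depends on \<open>Z\<close> only through the block means,
  because the log-likelihood is affine in the block sums.\<close>

lemma cross_entropy_geometric_vec_pmf:
  assumes "p > 0" "\<forall>i<m. \<beta> i > 0" and Z: "set_pmf Z \<subseteq> carrier_vec (p * m)"
    and int: "\<And>i. i < m \<Longrightarrow> integrable (measure_pmf Z) (\<lambda>k. real (block_sum m p k i))"
    and E: "\<And>i. i < m \<Longrightarrow> measure_pmf.expectation Z (\<lambda>k. real (block_sum m p k i)) = \<beta> i"
  shows "integrable (measure_pmf Z) (\<lambda>k. - ln (pmf (geometric_vec_pmf m p \<beta>) k))"
    and "measure_pmf.expectation Z (\<lambda>k. - ln (pmf (geometric_vec_pmf m p \<beta>) k)) =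
      (\<Sum>i<m. (\<beta> i + real p) * ln (\<beta> i + real p) - \<beta> i * ln (\<beta> i) - real p * ln (real p))"
proof -
  let ?g = "\<lambda>i k. real (block_sum m p k i) * ln (\<beta> i / (real p + \<beta> i)) + real p * ln (real p / (real p + \<beta> i))"
  have cong: "AE k in measure_pmf Z. - ln (pmf (geometric_vec_pmf m p \<beta>) k) = - (\<Sum>i<m. ?g i k)"
    using ln_pmf_geometric_vec_pmf(2)[OF assms(1,2)] Z by (auto simp: AE_measure_pmf_iff)
  have int_g: "integrable (measure_pmf Z) (?g i)" if "i < m" for i
    using int[OF that] by simp
  show "integrable (measure_pmf Z) (\<lambda>k. - ln (pmf (geometric_vec_pmf m p \<beta>) k))"
    using int_g by (subst integrable_cong_AE[OF _ _ cong]) (intro Bochner_Integration.integrable_minus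
        Bochner_Integration.integrable_sum | simp)+
  have "measure_pmf.expectation Z (\<lambda>k. - ln (pmf (geometric_vec_pmf m p \<beta>) k)) =
      measure_pmf.expectation Z (\<lambda>k. - (\<Sum>i<m. ?g i k))"
    by (rule integral_cong_AE[OF _ _ cong]) auto
  also have "\<dots> = - (\<Sum>i<m. measure_pmf.expectation Z (?g i))"
    unfolding Bochner_Integration.integral_minus using int_g
    by (subst Bochner_Integration.integral_sum) (simp_all only: lessThan_iff)
  also have "\<dots> = - (\<Sum>i<m. \<beta> i * ln (\<beta> i / (real p + \<beta> i)) + real p * ln (real p / (real p + \<beta> i)))"
    using int E by (intro arg_cong[of _ _ uminus] sum.cong refl) simp
  also have "\<dots> = (\<Sum>i<m. (\<beta> i + real p) * ln (\<beta> i + real p) - \<beta> i * ln (\<beta> i) - real p * ln (real p))"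
    unfolding sum_negf[symmetric]
  proof (intro sum.cong refl)
    fix i assume "i \<in> {..<m}"
    then have "\<beta> i > 0"
      using assms(2) by simp
    then show "- (\<beta> i * ln (\<beta> i / (real p + \<beta> i)) + real p * ln (real p / (real p + \<beta> i))) =
        (\<beta> i + real p) * ln (\<beta> i + real p) - \<beta> i * ln (\<beta> i) - real p * ln (real p)"
      using assms(1) by (simp add: ln_div add.commute algebra_simps)
  qed
  finally show "measure_pmf.expectation Z (\<lambda>k. - ln (pmf (geometric_vec_pmf m p \<beta>) k)) =
      (\<Sum>i<m. (\<beta> i + real p) * ln (\<beta> i + real p) - \<beta> i * ln (\<beta> i) - real p * ln (real p))" .
qed

section \<open>Identification of the maximum-entropy vector\<close>

text \<open>Every feasible vector, \<open>?Y\<close> included, has the same cross entropy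
  \<open>?h\<close> against \<open>?Y\<close>, so \<open>?h\<close> is also the entropy of
  \<open>?Y\<close>. Maximality makes the entropy of \<open>X\<close> at least \<open>?h\<close>,
  and the equality case of Gibbs' inequality forces \<open>X = ?Y\<close>.\<close>

lemma max_entropy_block:
  assumes "p > 0" "\<forall>i<m. \<beta> i > 0"
    and mc: "\<And>Z. mean_constraint A b Z \<longleftrightarrow> set_pmf Z \<subseteq> carrier_vec (p * m) \<and>
      (\<forall>i<m. integrable (measure_pmf Z) (\<lambda>k. real (block_sum m p k i)) \<and>
        measure_pmf.expectation Z (\<lambda>k. real (block_sum m p k i)) = \<beta> i)"
    and max: "max_entropy_vector A b X"
  shows "X = geometric_vec_pmf m p \<beta>"
    and "pmf_entropy X = (\<Sum>i<m. (\<beta> i + real p) * ln (\<beta> i + real p) - \<beta> i * ln (\<beta> i) - real p * ln (real p))"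
proof -
  let ?Y = "geometric_vec_pmf m p \<beta>"
  let ?h = "\<Sum>i<m. (\<beta> i + real p) * ln (\<beta> i + real p) - \<beta> i * ln (\<beta> i) - real p * ln (real p)"
  have X: "mean_constraint A b X" "finite_entropy X"
    using max by (auto simp: max_entropy_vector_def)
  have Y: "mean_constraint A b ?Y"
    unfolding mc using set_geometric_vec_pmf_subset geometric_vec_pmf_block_sum[OF assms(1,2)] by blast
  have cross: "integrable (measure_pmf Z) (\<lambda>k. - ln (pmf ?Y k))"
    "measure_pmf.expectation Z (\<lambda>k. - ln (pmf ?Y k)) = ?h" if "mean_constraint A b Z" for Z
    using that cross_entropy_geometric_vec_pmf[OF assms(1,2), of Z] unfolding mc by blast+
  have HY: "pmf_entropy ?Y = ?h"
    by (rule trans[OF pmf_entropy_eq_expectation[OF cross(1)[OF Y]] cross(2)[OF Y]])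
  have "?h \<le> pmf_entropy X"
    using max Y HY unfolding max_entropy_vector_def by auto
  moreover have "set_pmf X \<subseteq> set_pmf ?Y"
  proof
    fix k assume "k \<in> set_pmf X"
    then have "k \<in> carrier_vec (p * m)"
      using X(1) mc by blast
    then show "k \<in> set_pmf ?Y"
      using ln_pmf_geometric_vec_pmf(1)[OF assms(1,2), of k] by (simp add: set_pmf_iff)
  qed
  ultimately show "X = ?Y"
    using X(2) cross[OF X(1)] by (intro pmf_eq_of_cross_entropy_le) simp_all
  then show "pmf_entropy X = ?h"
    using HY by simp
qed

text \<open>Coordinate \<open>i\<close> is the term \<open>t = 0\<close> of its block sum, and the
  other terms are nonnegative. This provides the hypothesis \<open>\<beta> i > 0\<close> of the
  geometric vector.\<close>

lemma block_mean_pos: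
  assumes "p > 0" "i < m" "coord_mean X i > 0"
    and int: "integrable (measure_pmf X) (\<lambda>k. real (block_sum m p k i))"
  shows "measure_pmf.expectation X (\<lambda>k. real (block_sum m p k i)) > 0"
proof -
  have "k $ i \<le> block_sum m p k i" for k :: "nat Matrix.vec"
    unfolding block_sum_def using member_le_sum[of 0 "{..<p}" "\<lambda>t. k $ (t * m + i)"] assms(1) by simp
  then have "coord_mean X i \<le> measure_pmf.expectation X (\<lambda>k. real (block_sum m p k i))"
    unfolding coord_mean_def using int by (intro integral_mono') auto
  then show ?thesis
    using assms(3) by simp
qed

section \<open>The bound for fixed p and the conclusion\<close>

lemma card_solutions_le_entropy_bound:
  fixes A B C :: "real mat"
  assumes "p > 0" and A: "A \<in> carrier_mat m (p * m)" and B: "B \<in> carrier_mat m m" and C: "C \<in> carrier_mat m m"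
    and BC: "B * C = 1\<^sub>m m" and CB: "C * B = 1\<^sub>m m"
    and cols: "\<forall>i<m. \<forall>t<p. col A (t * m + i) = col B i"
    and b: "b \<in> carrier_vec m" and max: "max_entropy_vector A b X" and fin: "bound_finite m X"
  shows "real (card (nonneg_solutions A b \<inter> integer_vecs (p * m))) \<le> entropy_bound m p X"
proof (cases "nonneg_solutions A b \<inter> integer_vecs (p * m) = {}")
  case True
  have "0 \<le> entropy_bound m p X"
    unfolding entropy_bound_def by (intro mult_nonneg_nonneg prod_nonneg) auto
  then show ?thesis
    using True by simp
next
  case False
  let ?S = "nonneg_solutions A b \<inter> integer_vecs (p * m)"
  define \<beta> where "\<beta> i = (C *\<^sub>v b) $ i" for i
  note mc = mean_constraint_iff_block[OF A B C BC CB cols b, folded \<beta>_def]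
  have X: "mean_constraint A b X"
    using max by (simp add: max_entropy_vector_def)
  have pos: "\<beta> i > 0" if i: "i < m" for i
  proof -
    have "coord_mean X i \<ge> 0"
      by (simp add: coord_mean_def)
    \<comment> \<open>Mean 0 would give the floor 1 and the factor \<open>1 - 1 = 0\<close>, which
      \<open>bound_finite\<close> excludes.\<close>
    moreover have "coord_mean X i \<noteq> 0"
      using fin i by (auto simp: bound_finite_def)
    moreover have "integrable (measure_pmf X) (\<lambda>k. real (block_sum m p k i))"
      "measure_pmf.expectation X (\<lambda>k. real (block_sum m p k i)) = \<beta> i"
      using X i unfolding mc by blast+
    ultimately show ?thesis
      using block_mean_pos[OF assms(1) i, of X] by simp
  qed
  then have \<beta>: "\<forall>i<m. \<beta> i > 0"
    by blast
  note XY = max_entropy_block[OF assms(1) \<beta> mc max]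
  have sol: "x \<in> carrier_vec (p * m) \<and> (\<forall>j<p * m. 0 \<le> x $ j \<and> x $ j \<in> \<int>) \<and> (\<forall>i<m. block_sum m p x i = \<beta> i)"
    if "x \<in> ?S" for x
    using that A block_sum_eq_mult_mat_vec[OF A B C CB cols, of x]
    by (auto simp: nonneg_solutions_def integer_vecs_def \<beta>_def)
  define N where "N i = nat \<lfloor>\<beta> i\<rfloor>" for i
  \<comment> \<open>The existence of a lattice point enters here: its block sums are integers and
    equal the \<open>\<beta> i\<close>.\<close>
  have N: "real (N i) = \<beta> i" if i: "i < m" for i
  proof -
    obtain x where x: "x \<in> ?S"
      using False by blast
    have "block_sum m p x i \<in> \<int>"
      unfolding block_sum_def using sol[OF x] block_index_less[OF _ i] by (intro Ints_sum) auto
    then have "\<beta> i \<in> \<int>"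
      using sol[OF x] i by simp
    then show ?thesis
      using pos[OF i] by (auto simp: N_def elim!: Ints_cases)
  qed
  have mean: "coord_mean X i = real (N i) / real p" if "i < m" for i
    unfolding XY(1) using geometric_vec_pmf_coord(2)[OF assms(1) \<beta>, of i] that
      block_index_less[OF assms(1) that] N by simp
  have "real (card ?S) \<le> real (\<Prod>i<m. (N i + p - 1) choose (N i))"
    using sol N by (intro of_nat_mono card_block_solutions_le) auto
  also have "\<dots> = (\<Prod>i<m. real ((N i + p - 1) choose (N i)))"
    by simp
  also have "\<dots> \<le> (\<Prod>i<m. exp (real (N i + p) * ln (real (N i + p)) - real (N i) * ln (real (N i)) - real p * ln (real p)) *
      (pi * real p / 6 * ((real_of_int \<lfloor>real (N i) / real p + 1\<rfloor>)\<^sup>2 - 1)) powr (- 1 / 2))"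
  proof (intro prod_mono conjI)
    fix i assume "i \<in> {..<m}"
    then show "real ((N i + p - 1) choose (N i)) \<le>
        exp (real (N i + p) * ln (real (N i + p)) - real (N i) * ln (real (N i)) - real p * ln (real p)) *
        (pi * real p / 6 * ((real_of_int \<lfloor>real (N i) / real p + 1\<rfloor>)\<^sup>2 - 1)) powr (- 1 / 2)"
      using fin mean assms(1) by (intro multichoose_le_floor_bound) (auto simp: bound_finite_def)
  qed simp
  \<comment> \<open>The entropy is a sum over blocks, so its exponential splits into the same
    product.\<close>
  also have "\<dots> = entropy_bound m p X"
    unfolding entropy_bound_def XY(2) exp_sum[OF finite_lessThan] prod.distrib
    using N mean by simp
  finally show ?thesis .
qed

theorem theorem3:
  fixes m :: nat
    and a :: "nat \<Rightarrow> real Matrix.vec"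
    and A :: "nat \<Rightarrow> real mat"
    and b :: "nat \<Rightarrow> real Matrix.vec"
    and X :: "nat \<Rightarrow> nat Matrix.vec pmf"
  assumes "m > 0"
    and "vectorspace.basis class_ring (module_vec TYPE(real) m) (a ` {..<m})"
    and "\<And>p. p * m > m \<Longrightarrow> A p \<in> carrier_mat m (p * m)"
    and "\<And>p. p * m > m \<Longrightarrow> vec_space.rank m (A p) = m"
    and "\<And>p i k. p * m > m \<Longrightarrow> i < m \<Longrightarrow> k < p \<Longrightarrow> col (A p) (k * m + i) = a i"
    and "\<And>p. p * m > m \<Longrightarrow> b p \<in> carrier_vec m"
    and "\<And>p. p * m > m \<Longrightarrow> max_entropy_vector (A p) (b p) (X p)"
  shows "\<exists>F :: nat \<Rightarrow> real.
    (\<forall>p. p * m > m \<longrightarrow>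
       real (card (nonneg_solutions (A p) (b p) \<inter> integer_vecs (p * m))) \<le> F p) \<and>
    F \<sim>[inf at_top (principal {p. bound_finite m (X p)})] (\<lambda>p. entropy_bound m p (X p))"
proof -
  let ?c = "\<lambda>p. real (card (nonneg_solutions (A p) (b p) \<inter> integer_vecs (p * m)))"
  \<comment> \<open>Where some factor is infinite, \<open>entropy_bound\<close> has a meaningless
    value, and the count itself serves as the upper bound. The filter sees only the other
    \<open>p\<close>, where \<open>?F\<close> and the bound coincide, so asymptotic equivalence is
    reflexivity.\<close>
  let ?F = "\<lambda>p. if bound_finite m (X p) then entropy_bound m p (X p) else ?c p"
  obtain B C where BC: "B \<in> carrier_mat m m" "C \<in> carrier_mat m m" "B * C = 1\<^sub>m m" "C * B = 1\<^sub>m m"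
    "\<And>i. i < m \<Longrightarrow> col B i = a i"
    using basis_columns_inverse[OF assms(2)] by blast
  have le: "?c p \<le> ?F p" if p: "p * m > m" for p
  proof (cases "bound_finite m (X p)")
    case True
    have "p > 0"
      using p by (cases p) auto
    then have "?c p \<le> entropy_bound m p (X p)"
      using assms(3,5,6,7)[OF p] BC True by (intro card_solutions_le_entropy_bound[where B = B and C = C]) auto
    then show ?thesis
      using True by simp
  qed simp
  have "eventually (\<lambda>p. ?F p = entropy_bound m p (X p)) (inf at_top (principal {p. bound_finite m (X p)}))"
    by (simp add: eventually_inf_principal)
  then have "?F \<sim>[inf at_top (principal {p. bound_finite m (X p)})] (\<lambda>p. entropy_bound m p (X p))"
    by (rule asymp_equiv_refl_ev)
  with le show ?thesis
    by (intro exI[of _ ?F] conjI allI impI)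
qed

end
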